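(* Let $G$ be a graph on the vertex set $[n]=\{1,\dots,n\}$. For each vertex $i$ let $\alpha_i$ denote the maximum size of an independent set of $G$ that contains $i$. Then every bipartite covering $\mathcal H$ of $G$ satisfies $$\mathrm{cap}(\mathcal H)\ \ge\ \sum_{i=1}^n \log_2\Big(\frac{n}{\alpha_i}\Big).$$
   Context: A bipartite covering of a graph $G$ on vertex set $[n]$ is a finite collection $\mathcal H=\{H_1,\dots,H_m\}$ of bipartite graphs, each with vertex set $V(H_i)\subseteq [n]$ (each $H_i$ is a bipartite subgraph of the complete graph on $[n]$, not necessarily a subgraph of $G$), such that every edge of $G$ is an edge of at least one $H_i$. Its capacity is $\mathrm{cap}(\mathcal H)=\sum_{i=1}^m |V(H_i)|$. *)

theory Defs
  imports Complex_Main "HOL-Library.Ramsey"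
begin

text \<open>A simple graph is a pair of a vertex set and a set of edges, each edge being a
  two-element set of vertices.\<close>

type_synonym 'a ugraph = "'a set \<times> 'a set set"

abbreviation verts :: "'a ugraph \<Rightarrow> 'a set" where
  "verts G \<equiv> fst G"

abbreviation edges :: "'a ugraph \<Rightarrow> 'a set set" where
  "edges G \<equiv> snd G"

definition simple_graph :: "'a ugraph \<Rightarrow> bool" where
  "simple_graph G \<longleftrightarrow> finite (verts G) \<and> edges G \<subseteq> [verts G]\<^bsup>2\<^esup>"

definition bipartite :: "'a ugraph \<Rightarrow> bool" where
  "bipartite G \<longleftrightarrow> simple_graph G \<and>
     (\<exists>A B. A \<union> B = verts G \<and> A \<inter> B = {} \<and>
        (\<forall>e\<in>edges G. \<exists>a\<in>A. \<exists>b\<in>B. e = {a, b}))"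

text \<open>The covering graphs are listed as \<open>H\<^sub>1, \<dots>, H\<^sub>m\<close>; repetitions are allowed and are
  counted with multiplicity in the capacity. They need not be subgraphs of \<open>G\<close>, and they may
  have isolated vertices.\<close>

definition bipartite_covering :: "'a ugraph list \<Rightarrow> 'a ugraph \<Rightarrow> bool" where
  "bipartite_covering Hs G \<longleftrightarrow>
     (\<forall>H\<in>set Hs. bipartite H \<and> verts H \<subseteq> verts G) \<and>
     (\<forall>e\<in>edges G. \<exists>H\<in>set Hs. e \<in> edges H)"

definition capacity :: "'a ugraph list \<Rightarrow> nat" where
  "capacity Hs = (\<Sum>H\<leftarrow>Hs. card (verts H))"

definition indep_num_at :: "'a ugraph \<Rightarrow> 'a \<Rightarrow> nat" where
  "indep_num_at G i = Max {card S |S. S \<subseteq> verts G \<and> indep S (edges G) \<and> i \<in> S}"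

text \<open>The maximum is taken over a finite nonempty set, so it is attained.\<close>

lemma indep_num_at_set:
  assumes "simple_graph G" "i \<in> verts G"
  shows "finite {card S |S. S \<subseteq> verts G \<and> indep S (edges G) \<and> i \<in> S}"
    and "1 \<in> {card S |S. S \<subseteq> verts G \<and> indep S (edges G) \<and> i \<in> S}"
proof -
  have "{card S |S. S \<subseteq> verts G \<and> indep S (edges G) \<and> i \<in> S} \<subseteq> card ` Pow (verts G)"
    by blast
  then show "finite {card S |S. S \<subseteq> verts G \<and> indep S (edges G) \<and> i \<in> S}"
    using assms by (auto simp: simple_graph_def intro: finite_subset)
  have "{i} \<subseteq> verts G \<and> indep {i} (edges G) \<and> i \<in> {i} \<and> card {i} = 1"
    using assms by (simp add: indep_def)
  then show "1 \<in> {card S |S. S \<subseteq> verts G \<and> indep S (edges G) \<and> i \<in> S}"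
    by (smt (verit) mem_Collect_eq)
qed

end

theory Submission
  imports Defs
begin

text \<open>Deleting from \<open>{1..n}\<close> one colour class of each \<open>H\<close>, chosen by independent fair coin
  flips, leaves an independent set \<open>I\<close> of \<open>G\<close> that contains \<open>i\<close> with probability
  \<open>2\<^sup>-\<^sup>d\<close>, where \<open>d = d\<^sub>i\<close> is the number of \<open>H\<close> containing \<open>i\<close>. Since
  \<open>\<alpha>\<^sub>i \<ge> card I\<close> for \<open>i \<in> I\<close>, the weights \<open>1 / \<alpha>\<^sub>i\<close> sum to at most 1 over \<open>I\<close>; taking
  expectations, \<open>\<Sum>\<^sub>i (1/2)^d\<^sub>i / \<alpha>\<^sub>i \<le> 1\<close>. Concavity of the logarithm turns this into
  \<open>\<Sum>\<^sub>i (log\<^sub>2 (n / \<alpha>\<^sub>i) - d\<^sub>i) \<le> 0\<close>, and \<open>\<Sum>\<^sub>i d\<^sub>i\<close> is the capacity.\<close>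

definition cover_degree :: "'a ugraph list \<Rightarrow> 'a \<Rightarrow> nat" where
  "cover_degree Hs i = length (filter (\<lambda>H. i \<in> verts H) Hs)"

lemma cover_degree_simps [simp]:
  "cover_degree [] i = 0"
  "cover_degree (H # Hs) i = (if i \<in> verts H then 1 else 0) + cover_degree Hs i"
  by (simp_all add: cover_degree_def)

lemma capacity_eq_sum_cover_degree:
  assumes "finite V" and "\<forall>H\<in>set Hs. verts H \<subseteq> V"
  shows "capacity Hs = (\<Sum>i\<in>V. cover_degree Hs i)"
  using assms(2)
proof (induction Hs)
  case Nil
  then show ?case by (simp add: capacity_def)
next
  case (Cons H Hs)
  have "(\<Sum>i\<in>V. if i \<in> verts H then 1 else 0) = card (V \<inter> verts H)"
    using assms(1) by (simp flip: sum.inter_restrict)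
  moreover have "V \<inter> verts H = verts H"
    using Cons.prems by auto
  ultimately show ?case
    using Cons by (simp add: capacity_def sum.distrib)
qed

text \<open>The random deletion is derandomised by conditional expectations.\<close>

lemma exists_heavy_set_avoiding_edges:
  fixes w :: "'a \<Rightarrow> real"
  assumes "finite V" and "\<forall>H\<in>set Hs. bipartite H"
  shows "\<exists>I\<subseteq>V. (\<forall>H\<in>set Hs. \<forall>e\<in>edges H. \<not> e \<subseteq> I) \<and>
           (\<Sum>i\<in>V. w i * (1/2) ^ cover_degree Hs i) \<le> (\<Sum>i\<in>I. w i)"
  using assms
proof (induction Hs arbitrary: V)
  case Nil
  then show ?case by auto
next
  case (Cons H Hs)
  obtain A B where AB: "A \<union> B = verts H" "A \<inter> B = {}"
    and edg: "\<forall>e\<in>edges H. \<exists>a\<in>A. \<exists>b\<in>B. e = {a, b}"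
    using Cons.prems by (auto simp: bipartite_def)
  define c where "c i = w i * (1/2) ^ cover_degree Hs i" for i
  \<comment> \<open>Putting both deletions over the same index set \<open>V\<close> lets their sums
    be compared term by term.\<close>
  have diff: "(\<Sum>i\<in>V - X. c i) = (\<Sum>i\<in>V. if i \<in> X then 0 else c i)" for X
  proof -
    have "(\<Sum>i\<in>V - X. c i) = (\<Sum>i\<in>V - X. if i \<in> X then 0 else c i)"
      by (rule sum.cong) auto
    also have "\<dots> = (\<Sum>i\<in>V. if i \<in> X then 0 else c i)"
      using Cons.prems(1) by (intro sum.mono_neutral_left) auto
    finally show ?thesis .
  qed
  \<comment> \<open>A vertex of \<open>H\<close> lies in exactly one of \<open>A\<close> and
    \<open>B\<close>, so it survives one of the two deletions; any other vertex survives both. This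
    matches the extra factor 1/2 that \<open>H\<close> contributes exactly at its own vertices.
    Hence the left sum is the average of the two, and the better deletion attains it.\<close>
  have "2 * (\<Sum>i\<in>V. w i * (1/2) ^ cover_degree (H # Hs) i) =
        (\<Sum>i\<in>V - A. c i) + (\<Sum>i\<in>V - B. c i)"
    unfolding diff sum_distrib_left sum.distrib [symmetric]
    using AB by (intro sum.cong) (auto simp: c_def)
  then have "(\<Sum>i\<in>V. w i * (1/2) ^ cover_degree (H # Hs) i) \<le> (\<Sum>i\<in>V - A. c i) \<or>
    (\<Sum>i\<in>V. w i * (1/2) ^ cover_degree (H # Hs) i) \<le> (\<Sum>i\<in>V - B. c i)"
    by linarith
  then obtain X where X: "X \<in> {A, B}"
    and le: "(\<Sum>i\<in>V. w i * (1/2) ^ cover_degree (H # Hs) i) \<le> (\<Sum>i\<in>V - X. c i)"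
    by blast
  obtain I where I: "I \<subseteq> V - X" "\<forall>H\<in>set Hs. \<forall>e\<in>edges H. \<not> e \<subseteq> I"
    "(\<Sum>i\<in>V - X. c i) \<le> (\<Sum>i\<in>I. w i)"
    using Cons.IH [of "V - X"] Cons.prems by (auto simp: c_def)
  \<comment> \<open>Each edge of \<open>H\<close> has an end in both classes, so deleting either
    class destroys it.\<close>
  have "\<forall>e\<in>edges H. \<not> e \<subseteq> I"
    using edg X I(1) by fastforce
  then have "\<forall>H'\<in>set (H # Hs). \<forall>e\<in>edges H'. \<not> e \<subseteq> I"
    using I(2) by simp
  moreover have "I \<subseteq> V"
    using I(1) by blast
  ultimately show ?case
    using order_trans [OF le I(3)] by blast
qed

lemma card_le_indep_num_at:
  assumes "simple_graph G" and "I \<subseteq> verts G" and "indep I (edges G)" and "i \<in> I"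
  shows "card I \<le> indep_num_at G i"
proof -
  have "i \<in> verts G"
    using assms by blast
  moreover have "card I \<in> {card S |S. S \<subseteq> verts G \<and> indep S (edges G) \<and> i \<in> S}"
    using assms by blast
  ultimately show ?thesis
    unfolding indep_num_at_def by (intro Max_ge indep_num_at_set(1) [OF assms(1)])
qed

lemma indep_num_at_pos:
  assumes "simple_graph G" and "i \<in> verts G"
  shows "indep_num_at G i > 0"
  using Max_ge [OF indep_num_at_set [OF assms]] by (simp add: indep_num_at_def)

lemma sum_inverse_indep_num_at_le_1:
  assumes "simple_graph G" and "I \<subseteq> verts G" and "indep I (edges G)"
  shows "(\<Sum>i\<in>I. 1 / real (indep_num_at G i)) \<le> 1"
proof -
  have "finite I"
    using assms finite_subset by (auto simp: simple_graph_def)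
  have "(\<Sum>i\<in>I. 1 / real (indep_num_at G i)) \<le> (\<Sum>i\<in>I. 1 / real (card I))"
  proof (rule sum_mono)
    fix i assume "i \<in> I"
    then have "card I > 0"
      using \<open>finite I\<close> card_gt_0_iff by blast
    then show "1 / real (indep_num_at G i) \<le> 1 / real (card I)"
      using card_le_indep_num_at [OF assms \<open>i \<in> I\<close>] by (intro divide_left_mono) auto
  qed
  \<comment> \<open>The sum is 1 for nonempty \<open>I\<close> and 0 for empty
    \<open>I\<close>.\<close>
  also have "\<dots> \<le> 1"
    by simp
  finally show ?thesis .
qed

lemma sum_half_power_cover_degree_le_1:
  assumes "simple_graph G" and "bipartite_covering Hs G"
  shows "(\<Sum>i\<in>verts G. (1/2) ^ cover_degree Hs i / real (indep_num_at G i)) \<le> 1"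
proof -
  have "finite (verts G)" and "\<forall>H\<in>set Hs. bipartite H"
    using assms by (auto simp: simple_graph_def bipartite_covering_def)
  from exists_heavy_set_avoiding_edges [OF this, of "\<lambda>i. 1 / real (indep_num_at G i)"]
  obtain I where I: "I \<subseteq> verts G" "\<forall>H\<in>set Hs. \<forall>e\<in>edges H. \<not> e \<subseteq> I"
    and le: "(\<Sum>i\<in>verts G. (1/2) ^ cover_degree Hs i / real (indep_num_at G i))
               \<le> (\<Sum>i\<in>I. 1 / real (indep_num_at G i))"
    by auto
  \<comment> \<open>Every edge of \<open>G\<close> is an edge of some covering graph, and
    \<open>I\<close> contains no edge of those.\<close>
  have "indep I (edges G)"
    unfolding indep_def
  proof (intro ballI impI notI)
    fix v w assume vw: "v \<in> I" "w \<in> I" "{v, w} \<in> edges G"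
    then obtain H where "H \<in> set Hs" "{v, w} \<in> edges H"
      using assms(2) by (auto simp: bipartite_covering_def)
    then have "\<not> {v, w} \<subseteq> I"
      using I(2) by blast
    then show False
      using vw by simp
  qed
  then show ?thesis
    using le sum_inverse_indep_num_at_le_1 [OF assms(1) I(1)] by linarith
qed

theorem theorem1p4:
  fixes n :: nat and G :: "nat ugraph" and Hs :: "nat ugraph list"
  assumes "simple_graph G" and "verts G = {1..n}"
    and "bipartite_covering Hs G"
  shows "real (capacity Hs) \<ge> (\<Sum>i=1..n. log 2 (real n / real (indep_num_at G i)))"
proof -
  define d where "d = cover_degree Hs"
  define p where "p i = (1/2) ^ d i / real (indep_num_at G i)" for i
  \<comment> \<open>Concavity enters as the tangent bound ln x \<le> x - 1 at x =
    \<open>real n * p i\<close>. The tangent point 1 is the right one: the \<open>p i\<close> sum to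
    at most 1, so these x average at most 1 and the bounds sum to at most 0.\<close>
  have bound: "log 2 (real n / real (indep_num_at G i)) - real (d i) \<le> (real n * p i - 1) / ln 2"
    if i: "i \<in> {1..n}" for i
  proof -
    have pos: "real n / real (indep_num_at G i) > 0"
      using i assms indep_num_at_pos [of G i] by simp
    have "log 2 (real n / real (indep_num_at G i)) - real (d i)
            = log 2 (real n / real (indep_num_at G i) / 2 ^ d i)"
      using pos by (subst log_divide) (auto simp: log_nat_power)
    also have "\<dots> = log 2 (real n * p i)"
      by (simp add: p_def power_one_over field_simps)
    also have "\<dots> \<le> (real n * p i - 1) / ln 2"
    proof -
      have "real n * p i > 0"
        using pos by (simp add: p_def zero_less_divide_iff)
      then show ?thesis
        by (simp add: log_def divide_right_mono ln_le_minus_one)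
    qed
    finally show ?thesis .
  qed
  have cap: "real (capacity Hs) = (\<Sum>i=1..n. real (d i))"
    using capacity_eq_sum_cover_degree [of "verts G" Hs] assms
    by (simp add: d_def bipartite_covering_def)
  have "(\<Sum>i=1..n. log 2 (real n / real (indep_num_at G i))) - real (capacity Hs)
          \<le> (\<Sum>i=1..n. (real n * p i - 1) / ln 2)"
    unfolding cap sum_subtractf [symmetric] by (rule sum_mono) (rule bound)
  also have "\<dots> = (real n * (\<Sum>i=1..n. p i) - real n) / ln 2"
    by (simp add: sum_divide_distrib [symmetric] sum_subtractf sum_distrib_left)
  also have "\<dots> \<le> 0"
  proof -
    have "(\<Sum>i=1..n. p i) \<le> 1"
      using sum_half_power_cover_degree_le_1 [OF assms(1,3)] assms(2) by (simp add: p_def d_def)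
    then have "real n * (\<Sum>i=1..n. p i) \<le> real n"
      by (intro mult_left_le) auto
    then show ?thesis
      by (intro divide_nonpos_pos) auto
  qed
  finally show ?thesis
    by linarith
qed

end
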